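(* Let $A$ and $B$ be unital complex Banach algebras. Then $A^{-1}_e$ is isometrically isomorphic to $B^{-1}_e$ as a metrizable group if and only if $A^{-1}$ is isometrically isomorphic to $B^{-1}$ as a metrizable group. In this case $A$ is isometrically isomorphic to $B$ as a real Banach algebra.
   Context: $A^{-1}$ denotes the multiplicative group of all invertible elements of a unital Banach algebra $A$, with the metric induced by the norm, and $A^{-1}_e$ denotes its principal component, i.e. the connected component of $A^{-1}$ containing the unit. Two such groups are isometrically isomorphic as metrizable groups if there is a group isomorphism from one onto the other that preserves the norm distance. $A$ and $B$ are isometrically isomorphic as real Banach algebras if there is a bijective, real-linear, multiplicative isometry from $A$ onto $B$. Unital Banach algebras are complex, have submultiplicative norm, and the unit has norm $1$. *)

theory Defs
  imports "HOL-Analysis.Analysis" "HOL-Algebra.Algebra"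
begin

(* The real scalar multiplication of the underlying real Banach algebra is the restriction
   of the complex one. That the norm is submultiplicative and that the unit has norm 1 is
   part of real_normed_algebra_1. *)
class complex_banach_algebra_1 = real_normed_algebra_1 + banach +
  fixes scaleC :: "complex \<Rightarrow> 'a \<Rightarrow> 'a" (infixr "*\<^sub>C" 75)
  assumes scaleC_add_right: "c *\<^sub>C (x + y) = c *\<^sub>C x + c *\<^sub>C y"
    and scaleC_add_left: "(c + d) *\<^sub>C x = c *\<^sub>C x + d *\<^sub>C x"
    and scaleC_scaleC: "c *\<^sub>C d *\<^sub>C x = (c * d) *\<^sub>C x"
    and scaleC_complex_of_real: "complex_of_real r *\<^sub>C x = r *\<^sub>R x"
    and mult_scaleC_left: "(c *\<^sub>C x) * y = c *\<^sub>C (x * y)"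
    and mult_scaleC_right: "x * (c *\<^sub>C y) = c *\<^sub>C (x * y)"
    and norm_scaleC: "norm (c *\<^sub>C x) = cmod c * norm x"

instantiation complex :: complex_banach_algebra_1
begin

definition scaleC_complex :: "complex \<Rightarrow> complex \<Rightarrow> complex"
  where "scaleC_complex c x = c * x"

instance
  by standard (simp_all add: scaleC_complex_def algebra_simps scaleR_conv_of_real norm_mult)

end

definition mult_monoid :: "'a::monoid_mult monoid"
  where "mult_monoid = \<lparr>carrier = UNIV, monoid.mult = (*), one = 1\<rparr>"

definition invertible_group :: "'a::monoid_mult monoid"
  where "invertible_group = units_of mult_monoid"

definition principal_component :: "'a::{monoid_mult,topological_space} set"
  where "principal_component = connected_component_set (carrier invertible_group) 1"

definition principal_component_group :: "'a::{monoid_mult,topological_space} monoid"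
  where "principal_component_group = invertible_group\<lparr>carrier := principal_component\<rparr>"

definition isometrically_isomorphic_groups ::
    "'a::metric_space monoid \<Rightarrow> 'b::metric_space monoid \<Rightarrow> bool"
  where "isometrically_isomorphic_groups G H \<longleftrightarrow>
    (\<exists>\<phi> \<in> iso G H. \<forall>x \<in> carrier G. \<forall>y \<in> carrier G. dist (\<phi> x) (\<phi> y) = dist x y)"

definition isometric_real_algebra_iso ::
    "('a::real_normed_algebra_1 \<Rightarrow> 'b::real_normed_algebra_1) \<Rightarrow> bool"
  where "isometric_real_algebra_iso T \<longleftrightarrow>
    linear T \<and> bij T \<and> (\<forall>x y. T (x * y) = T x * T y) \<and> (\<forall>x y. dist (T x) (T y) = dist x y)"

lemma monoid_mult_monoid: "monoid mult_monoid"
  by (rule monoidI) (simp_all add: mult_monoid_def mult.assoc)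

lemma group_invertible_group: "group invertible_group"
  unfolding invertible_group_def by (rule monoid.units_group[OF monoid_mult_monoid])

lemma carrier_invertible_group: "carrier invertible_group = {x. \<exists>y. y * x = 1 \<and> x * y = 1}"
  by (simp add: invertible_group_def units_of_def Units_def mult_monoid_def)

lemma mult_invertible_group [simp]: "x \<otimes>\<^bsub>invertible_group\<^esub> y = x * y"
  by (simp add: invertible_group_def units_of_def mult_monoid_def)

lemma one_invertible_group [simp]: "\<one>\<^bsub>invertible_group\<^esub> = 1"
  by (simp add: invertible_group_def units_of_def mult_monoid_def)

lemma principal_component_translate:
  fixes u v x :: "'a::real_normed_algebra_1"
  assumes u: "u \<in> carrier invertible_group"
    and "v \<in> principal_component" "u * v \<in> principal_component" "x \<in> principal_component"
  shows "u * x \<in> principal_component"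
proof -
  let ?G = "carrier invertible_group :: 'a set"
  let ?C = "principal_component :: 'a set"
  have "connected ((*) u ` ?C)"
    unfolding principal_component_def
    by (intro connected_continuous_image continuous_intros connected_connected_component)
  moreover have "?C \<subseteq> ?G"
    unfolding principal_component_def by (rule connected_component_subset)
  then have "(*) u ` ?C \<subseteq> ?G"
    using monoid.m_closed[OF group.is_monoid[OF group_invertible_group] u] by auto
  ultimately have "connected_component ?G (u * v) (u * x)"
    unfolding connected_component_def using assms by blast
  then show ?thesis
    using assms(3) unfolding principal_component_def
    by (auto intro: connected_component_trans)
qed

lemma subgroup_principal_component:
  "subgroup (principal_component :: 'a::real_normed_algebra_1 set) invertible_group"
proof -
  let ?G = "invertible_group :: 'a monoid"
  interpret group ?G by (rule group_invertible_group)
  have one: "1 \<in> (principal_component :: 'a set)"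
    using one_closed by (simp add: principal_component_def)
  have sub: "principal_component \<subseteq> carrier ?G"
    unfolding principal_component_def by (rule connected_component_subset)
  show ?thesis
  proof (rule subgroupI)
    fix a :: 'a assume a: "a \<in> principal_component"
    then have G: "a \<in> carrier ?G" using sub by blast
    have "(inv\<^bsub>?G\<^esub> a) * a = 1" using l_inv[OF G] by simp
    then show "inv\<^bsub>?G\<^esub> a \<in> principal_component"
      using principal_component_translate[OF inv_closed[OF G] a _ one] one by simp
    fix b :: 'a assume "b \<in> principal_component"
    then show "a \<otimes>\<^bsub>?G\<^esub> b \<in> principal_component"
      using principal_component_translate[OF G one] a by simp
  qed (use sub one in auto)
qed

end

theory Submission
  imports Defs
begin

text \<open>Both equivalences reduce to a local statement. Let \<open>G\<close> and \<open>H\<close> be groups of invertible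
  elements which contain the open unit balls around the units, and let \<open>\<phi>\<close> be an isometric
  isomorphism of \<open>G\<close> onto \<open>H\<close>. As \<open>\<phi> 1 = 1\<close>, the map \<open>f x = \<phi> (1 + x) - 1\<close> is an isometry of
  the open unit ball at \<open>0\<close> onto the open unit ball at \<open>0\<close>. A local form of the Mazur--Ulam theorem
  says that \<open>f\<close> agrees near \<open>0\<close> with a surjective real-linear isometry \<open>S\<close>. Expanding
  \<open>\<phi> ((1 + x) (1 + y)) = \<phi> (1 + x) \<phi> (1 + y)\<close> for small \<open>x\<close> and \<open>y\<close> and cancelling the linear
  terms leaves \<open>S (x y) = S x S y\<close>; by homogeneity this holds everywhere. So \<open>S\<close> is an
  isometric isomorphism of real algebras.

  The open unit ball around \<open>1\<close> consists of invertible elements (Neumann series) and is convex, so it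
  lies in the principal component. Hence the argument applies to the full group of invertible
  elements and to its principal component alike. In the other direction an isometric isomorphism of
  real algebras preserves invertibility, and it preserves the principal component because it is a
  homeomorphism fixing the unit; so it restricts to an isometric isomorphism of either pair of
  groups. The two group conditions are therefore both equivalent to the algebra condition.

  The local Mazur--Ulam theorem uses the reflection idea of Vogt and Vaisala: the centre of a
  bounded centrally symmetric set is fixed by every isometry of the set onto itself, and the
  metric midpoints of \<open>x\<close> and \<open>y\<close> form such a set with centre \<open>(x + y) / 2\<close>.\<close>

section \<open>Isometries and midpoints\<close>

definition isometric_bijection :: "('a::metric_space \<Rightarrow> 'b::metric_space) \<Rightarrow> 'a set \<Rightarrow> 'b set \<Rightarrow> bool"
  where "isometric_bijection f K L \<longleftrightarrow>
    bij_betw f K L \<and> (\<forall>x\<in>K. \<forall>y\<in>K. dist (f x) (f y) = dist x y)"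

lemma isometric_bijection_comp:
  assumes "isometric_bijection f K L" "isometric_bijection g L M"
  shows "isometric_bijection (g \<circ> f) K M"
  using assms unfolding isometric_bijection_def
  by (auto intro: bij_betw_trans simp: bij_betw_apply)

lemma isometric_bijection_inv_into:
  assumes "isometric_bijection f K L"
  shows "isometric_bijection (inv_into K f) L K"
proof -
  have b: "bij_betw f K L" using assms by (simp add: isometric_bijection_def)
  have "dist (inv_into K f x) (inv_into K f y) = dist x y" if "x \<in> L" "y \<in> L" for x y
    using assms that bij_betw_inv_into_right[OF b] bij_betw_apply[OF bij_betw_inv_into[OF b]]
    unfolding isometric_bijection_def by metis
  then show ?thesis
    using bij_betw_inv_into[OF b] by (simp add: isometric_bijection_def)
qed

lemma isometric_bijection_reflection:
  fixes z :: "'a::real_normed_vector"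
  assumes "\<And>u. u \<in> K \<Longrightarrow> 2 *\<^sub>R z - u \<in> K"
  shows "isometric_bijection (\<lambda>u. 2 *\<^sub>R z - u) K K"
  unfolding isometric_bijection_def
  by (auto simp: dist_norm norm_minus_commute
      intro!: bij_betw_byWitness[where f' = "\<lambda>u. 2 *\<^sub>R z - u"] assms)

text \<open>If \<open>\<psi>\<close> is the reflection in \<open>z\<close>, then \<open>\<psi> \<circ> g\<^sup>-\<^sup>1 \<circ> \<psi> \<circ> g\<close> moves \<open>z\<close> twice as far as \<open>g\<close> does.
  Iterating this construction would lead out of a bounded set unless \<open>g\<close> fixes \<open>z\<close>.\<close>

lemma isometric_bijection_fixes_centre:
  fixes z :: "'a::real_normed_vector"
  assumes "bounded K" and z: "z \<in> K" and sym: "\<And>u. u \<in> K \<Longrightarrow> 2 *\<^sub>R z - u \<in> K"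
    and g: "isometric_bijection g K K"
  shows "g z = z"
proof -
  let ?\<psi> = "\<lambda>u. 2 *\<^sub>R z - u"
  obtain D where D: "\<And>u. u \<in> K \<Longrightarrow> dist z u \<le> D"
    using \<open>bounded K\<close> bounded_any_center[of K z] by auto
  have \<psi>: "isometric_bijection ?\<psi> K K"
    by (rule isometric_bijection_reflection[OF sym])
  have bound: "2 ^ n * dist z (h z) \<le> D" if "isometric_bijection h K K" for n h
    using that
  proof (induction n arbitrary: h)
    case 0
    then have "h z \<in> K" using z by (auto simp: isometric_bijection_def intro: bij_betw_apply)
    then show ?case using D by simp
  next
    case (Suc n)
    let ?i = "inv_into K h"
    have h: "bij_betw h K K" using Suc.prems by (simp add: isometric_bijection_def)
    have i: "isometric_bijection ?i K K" by (rule isometric_bijection_inv_into[OF Suc.prems])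
    have hz: "h z \<in> K" using h z by (rule bij_betw_apply)
    have "dist z ((?\<psi> \<circ> ?i \<circ> ?\<psi> \<circ> h) z) = dist (?\<psi> z) (?\<psi> (?i (?\<psi> (h z))))"
      by (simp add: scaleR_2)
    also have "\<dots> = dist z (?i (?\<psi> (h z)))"
      by (simp add: dist_norm norm_minus_commute)
    also have "\<dots> = dist (?i (h z)) (?i (?\<psi> (h z)))"
      using bij_betw_inv_into_left[OF h z] by simp
    also have "\<dots> = dist (h z) (?\<psi> (h z))"
      using i hz sym by (simp add: isometric_bijection_def)
    also have "\<dots> = norm (2 *\<^sub>R (z - h z))"
      by (simp add: dist_norm norm_minus_commute scaleR_2 algebra_simps)
    also have "\<dots> = 2 * dist z (h z)"
      by (simp add: dist_norm del: scaleR_right_diff_distrib)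
    finally show ?case
      using Suc.IH[OF isometric_bijection_comp[OF Suc.prems
            isometric_bijection_comp[OF \<psi> isometric_bijection_comp[OF i \<psi>]]]]
      by (simp add: o_assoc mult.assoc mult.left_commute)
  qed
  have "dist z (g z) = 0"
  proof (rule ccontr)
    assume "dist z (g z) \<noteq> 0"
    then have "0 < dist z (g z)" by simp
    moreover obtain n where "D / dist z (g z) < 2 ^ n"
      using real_arch_pow[of 2 "D / dist z (g z)"] by auto
    ultimately show False
      using bound[OF g, of n] by (simp add: field_simps)
  qed
  then show ?thesis by simp
qed

lemma isometric_bijection_maps_centre:
  fixes z :: "'a::real_normed_vector" and w :: "'b::real_normed_vector"
  assumes "bounded K" and z: "z \<in> K" and symK: "\<And>u. u \<in> K \<Longrightarrow> 2 *\<^sub>R z - u \<in> K"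
    and "w \<in> L" and symL: "\<And>v. v \<in> L \<Longrightarrow> 2 *\<^sub>R w - v \<in> L"
    and f: "isometric_bijection f K L"
  shows "f z = w"
proof -
  let ?i = "inv_into K f"
  have b: "bij_betw f K L" using f by (simp add: isometric_bijection_def)
  \<comment> \<open>The reflection of \<open>L\<close>, transported to \<open>K\<close> along \<open>f\<close>, must fix the centre of \<open>K\<close>.\<close>
  have "(?i \<circ> (\<lambda>v. 2 *\<^sub>R w - v) \<circ> f) z = z"
    using assms(1) z symK
  proof (rule isometric_bijection_fixes_centre)
    show "isometric_bijection (?i \<circ> (\<lambda>v. 2 *\<^sub>R w - v) \<circ> f) K K"
      using isometric_bijection_comp[OF f isometric_bijection_comp[OF
            isometric_bijection_reflection[OF symL] isometric_bijection_inv_into[OF f]]]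
      by (simp add: o_assoc)
  qed
  then have "f (?i (2 *\<^sub>R w - f z)) = f z" by simp
  moreover have "2 *\<^sub>R w - f z \<in> L" using symL bij_betw_apply[OF b z] .
  ultimately have "2 *\<^sub>R w - f z = f z"
    using bij_betw_inv_into_right[OF b] by simp
  then have "2 *\<^sub>R w = 2 *\<^sub>R f z" by (simp add: scaleR_2 algebra_simps)
  then show ?thesis by simp
qed

definition metric_midpoints :: "'a::metric_space \<Rightarrow> 'a \<Rightarrow> 'a set"
  where "metric_midpoints x y = {u. dist u x = dist x y / 2 \<and> dist u y = dist x y / 2}"

lemma bounded_metric_midpoints: "bounded (metric_midpoints x y)"
  by (rule bounded_subset[OF bounded_cball[of x "dist x y / 2"]])
    (auto simp: metric_midpoints_def dist_commute)

lemma midpoint_in_metric_midpoints: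
  "midpoint x y \<in> metric_midpoints x (y :: 'a::real_normed_vector)"
  by (simp add: metric_midpoints_def dist_midpoint)

lemma metric_midpoints_reflect:
  fixes x y :: "'a::real_normed_vector"
  assumes "u \<in> metric_midpoints x y"
  shows "2 *\<^sub>R midpoint x y - u \<in> metric_midpoints x y"
proof -
  have "2 *\<^sub>R midpoint x y = x + y" by (simp add: midpoint_def)
  then show ?thesis
    using assms by (simp add: metric_midpoints_def dist_norm norm_minus_commute)
qed

lemma metric_midpoints_subset_ball:
  fixes x y :: "'a::real_normed_vector"
  assumes "norm x < r / 2" "norm y < r / 2"
  shows "metric_midpoints x y \<subseteq> ball 0 r"
proof
  fix u assume "u \<in> metric_midpoints x y"
  then have "norm (u - x) = norm (x - y) / 2" by (simp add: metric_midpoints_def dist_norm)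
  then show "u \<in> ball 0 r"
    using norm_triangle_ineq4[of x y] norm_triangle_sub[of u x] assms by simp
qed

section \<open>A local Mazur--Ulam theorem\<close>

text \<open>Halving the radius keeps all metric midpoints inside the ball on which the isometry is given, and
  an isometry onto the ball matches the metric midpoints of two points with those of
  their images.\<close>

lemma isometric_bijection_ball_midpoint:
  fixes f :: "'a::real_normed_vector \<Rightarrow> 'b::real_normed_vector"
  assumes f: "isometric_bijection f (ball 0 r) (ball 0 r)" and f0: "f 0 = 0"
    and x: "norm x < r / 2" and y: "norm y < r / 2"
  shows "f (midpoint x y) = midpoint (f x) (f y)"
proof -
  let ?K = "metric_midpoints x y" and ?L = "metric_midpoints (f x) (f y)"
  have r: "0 < r" using x norm_ge_zero[of x] by linarith
  have xy: "x \<in> ball 0 r" "y \<in> ball 0 r" using x y r by auto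
  have bij: "bij_betw f (ball 0 r) (ball 0 r)"
    and iso: "\<And>u v. \<lbrakk>u \<in> ball 0 r; v \<in> ball 0 r\<rbrakk> \<Longrightarrow> dist (f u) (f v) = dist u v"
    using f by (auto simp: isometric_bijection_def)
  have norm_f: "norm (f u) = norm u" if "u \<in> ball 0 r" for u
    using iso[OF that, of 0] f0 r by (simp add: dist_norm)
  have K: "?K \<subseteq> ball 0 r" by (rule metric_midpoints_subset_ball[OF x y])
  have L: "?L \<subseteq> ball 0 r"
    using metric_midpoints_subset_ball[of "f x" r "f y"] x y norm_f xy by simp
  have mem: "f u \<in> ?L \<longleftrightarrow> u \<in> ?K" if "u \<in> ball 0 r" for u
    using iso[OF that xy(1)] iso[OF that xy(2)] iso[OF xy]
    by (simp add: metric_midpoints_def)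
  have "f ` ?K = ?L"
  proof
    show "f ` ?K \<subseteq> ?L" using mem K by blast
    show "?L \<subseteq> f ` ?K"
    proof
      fix v assume "v \<in> ?L"
      then have "v \<in> f ` ball 0 r" using L bij_betw_imp_surj_on[OF bij] by blast
      then show "v \<in> f ` ?K" using mem \<open>v \<in> ?L\<close> by blast
    qed
  qed
  then have f_mid: "isometric_bijection f ?K ?L"
    using bij_betw_subset[OF bij K] iso K unfolding isometric_bijection_def by blast
  show ?thesis
    by (rule isometric_bijection_maps_centre[OF bounded_metric_midpoints
          midpoint_in_metric_midpoints _ midpoint_in_metric_midpoints _ f_mid])
      (rule metric_midpoints_reflect, assumption)+
qed

text \<open>For fixed \<open>x\<close> the defect \<open>S (t *\<^sub>R x) - t *\<^sub>R S x\<close> is additive in \<open>t\<close> and vanishes at the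
  integers, so all its values are already taken on \<open>[0, 1]\<close>, where the norm bound applies. A bounded
  additive function is zero.\<close>

lemma linear_if_additive_norm_preserving:
  fixes S :: "'a::real_normed_vector \<Rightarrow> 'b::real_normed_vector"
  assumes add: "\<And>x y. S (x + y) = S x + S y" and norm: "\<And>x. norm (S x) = norm x"
  shows "linear S"
proof (rule linearI[OF add])
  fix t :: real and x :: 'a
  define d where "d t = S (t *\<^sub>R x) - t *\<^sub>R S x" for t
  have d_add: "d (s + t) = d s + d t" for s t
    by (simp add: d_def scaleR_add_left add)
  have d_nat: "d (real n * t) = real n *\<^sub>R d t" for n t
  proof (induction n)
    case 0
    show ?case using add[of 0 0] by (simp add: d_def)
  next
    case (Suc n)
    then show ?case by (simp add: d_add distrib_right scaleR_add_left)
  qed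
  have d1: "d 1 = 0" by (simp add: d_def)
  have d_of_nat: "d (real n) = 0" for n using d_nat[of n 1] d1 by simp
  have d_of_int: "d (of_int k) = 0" for k
  proof (cases k)
    case (nonneg n)
    then show ?thesis using d_of_nat by simp
  next
    case (neg n)
    have "d (of_int k) + d (real (Suc n)) = d 0" unfolding d_add[symmetric] using neg by simp
    then show ?thesis using d_of_nat[of "Suc n"] d_of_nat[of 0] by simp
  qed
  have d_bound: "norm (d s) \<le> 2 * norm x" for s
  proof -
    have "d s = d (of_int \<lfloor>s\<rfloor>) + d (frac s)"
      unfolding d_add[symmetric] by (simp add: frac_def)
    then have "d s = d (frac s)" by (simp add: d_of_int)
    also have "norm (d (frac s)) \<le> norm (S (frac s *\<^sub>R x)) + norm (frac s *\<^sub>R S x)"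
      unfolding d_def by (rule norm_triangle_ineq4)
    also have "\<dots> = 2 * (frac s * norm x)"
      by (simp add: norm frac_ge_0)
    also have "\<dots> \<le> 2 * norm x"
      using mult_right_mono[of "frac s" 1 "norm x"] frac_lt_1[of s] by simp
    finally show ?thesis by simp
  qed
  have "norm (d t) = 0"
  proof (rule ccontr)
    assume "norm (d t) \<noteq> 0"
    then have pos: "0 < norm (d t)" by simp
    obtain n where "2 * norm x < real n * norm (d t)"
      using reals_Archimedean3[OF pos] by blast
    then show False using d_bound[of "real n * t"] by (simp add: d_nat)
  qed
  then show "S (t *\<^sub>R x) = t *\<^sub>R S x" by (simp add: d_def)
qed

lemma eventually_norm_scaled_less:
  fixes x :: "'a::real_normed_vector"
  assumes "0 < e"
  shows "\<forall>\<^sub>F n in sequentially. norm ((1 / 2 ^ n) *\<^sub>R x) < e"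
proof -
  have "(\<lambda>n. (1 / 2 :: real) ^ n) \<longlonglongrightarrow> 0" by (rule LIMSEQ_realpow_zero) auto
  then have "(\<lambda>n. (1 / 2 :: real) ^ n *\<^sub>R x) \<longlonglongrightarrow> 0 *\<^sub>R x"
    by (rule tendsto_scaleR[OF _ tendsto_const])
  from tendsto_norm[OF this] have "(\<lambda>n. norm ((1 / 2 ^ n) *\<^sub>R x)) \<longlonglongrightarrow> 0"
    by (simp add: power_one_over)
  then show ?thesis using assms by (rule order_tendstoD)
qed

text \<open>Midpoint preservation makes \<open>f\<close> additive near \<open>0\<close> and compatible with halving. Hence
  \<open>2\<^sup>n f (x / 2\<^sup>n)\<close> does not depend on \<open>n\<close> once \<open>x / 2\<^sup>n\<close> is small; this eventual value defines the
  linear extension.\<close>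

theorem local_Mazur_Ulam:
  fixes f :: "'a::real_normed_vector \<Rightarrow> 'b::real_normed_vector"
  assumes r: "0 < r" and f: "isometric_bijection f (ball 0 r) (ball 0 r)" and f0: "f 0 = 0"
  obtains S where "linear S" "surj S" "\<And>x. norm (S x) = norm x"
    "\<And>x. norm x < r / 2 \<Longrightarrow> S x = f x"
proof -
  have bij: "bij_betw f (ball 0 r) (ball 0 r)"
    and iso: "\<And>u v. \<lbrakk>u \<in> ball 0 r; v \<in> ball 0 r\<rbrakk> \<Longrightarrow> dist (f u) (f v) = dist u v"
    using f by (auto simp: isometric_bijection_def)
  have norm_f: "norm (f u) = norm u" if "norm u < r" for u
    using iso[of u 0] that f0 r by (simp add: dist_norm)
  have half: "f ((1 / 2) *\<^sub>R x) = (1 / 2) *\<^sub>R f x" if "norm x < r / 2" for x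
    using isometric_bijection_ball_midpoint[OF f f0 that, of 0] r f0
    by (simp add: midpoint_def inverse_eq_divide)
  have add: "f (x + y) = f x + f y" if "norm x < r / 4" "norm y < r / 4" for x y
  proof -
    have "norm (x + y) < r / 2" using norm_triangle_ineq[of x y] that by linarith
    then have "(1 / 2) *\<^sub>R f (x + y) = f (midpoint x y)"
      using half by (simp add: midpoint_def inverse_eq_divide)
    also have "\<dots> = (1 / 2) *\<^sub>R (f x + f y)"
      using isometric_bijection_ball_midpoint[OF f f0, of x y] that r
      by (simp add: midpoint_def inverse_eq_divide)
    finally show ?thesis by simp
  qed
  have pow: "f ((1 / 2 ^ n) *\<^sub>R x) = (1 / 2 ^ n) *\<^sub>R f x" if "norm x < r / 2" for n x
  proof (induction n)
    case (Suc n)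
    have "norm ((1 / 2 ^ n) *\<^sub>R x) \<le> norm x"
      using mult_left_mono[of 1 "2 ^ n" "norm x"] by (simp add: divide_le_eq)
    then have "f ((1 / 2) *\<^sub>R (1 / 2 ^ n) *\<^sub>R x) = (1 / 2) *\<^sub>R f ((1 / 2 ^ n) *\<^sub>R x)"
      using that by (intro half) linarith
    then show ?case using Suc by simp
  qed simp
  define S where "S x = lim (\<lambda>n. 2 ^ n *\<^sub>R f ((1 / 2 ^ n) *\<^sub>R x))" for x
  have S_eq: "S x = 2 ^ n *\<^sub>R f ((1 / 2 ^ n) *\<^sub>R x)" if "norm ((1 / 2 ^ n) *\<^sub>R x) < r / 2" for x n
  proof -
    have "2 ^ m *\<^sub>R f ((1 / 2 ^ m) *\<^sub>R x) = 2 ^ n *\<^sub>R f ((1 / 2 ^ n) *\<^sub>R x)" if "n \<le> m" for m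
    proof -
      have m: "m = n + (m - n)" using that by simp
      have "f ((1 / 2 ^ m) *\<^sub>R x) = f ((1 / 2 ^ (m - n)) *\<^sub>R (1 / 2 ^ n) *\<^sub>R x)"
        by (subst m) (simp add: power_add mult.commute)
      also have "\<dots> = (1 / 2 ^ (m - n)) *\<^sub>R f ((1 / 2 ^ n) *\<^sub>R x)"
        using \<open>norm ((1 / 2 ^ n) *\<^sub>R x) < r / 2\<close> by (rule pow)
      finally show ?thesis using that by (simp add: power_diff)
    qed
    then have "(\<lambda>m. 2 ^ m *\<^sub>R f ((1 / 2 ^ m) *\<^sub>R x)) \<longlonglongrightarrow> 2 ^ n *\<^sub>R f ((1 / 2 ^ n) *\<^sub>R x)"
      by (intro tendsto_eventually eventually_sequentiallyI)
    then show ?thesis unfolding S_def by (rule limI)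
  qed
  have S_f: "S x = f x" if "norm x < r / 2" for x
    using S_eq[of 0 x] that by simp
  have S_add: "S (x + y) = S x + S y" for x y
  proof -
    have "\<forall>\<^sub>F n in sequentially. norm ((1 / 2 ^ n) *\<^sub>R x) < r / 4 \<and> norm ((1 / 2 ^ n) *\<^sub>R y) < r / 4"
      using r by (intro eventually_conj eventually_norm_scaled_less) auto
    then obtain n where n: "norm ((1 / 2 ^ n) *\<^sub>R x) < r / 4" "norm ((1 / 2 ^ n) *\<^sub>R y) < r / 4"
      by (auto simp: eventually_sequentially)
    have "norm ((1 / 2 ^ n) *\<^sub>R (x + y)) < r / 2"
      unfolding scaleR_add_right
      using norm_triangle_ineq[of "(1 / 2 ^ n) *\<^sub>R x" "(1 / 2 ^ n) *\<^sub>R y"] n by linarith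
    moreover have "norm ((1 / 2 ^ n) *\<^sub>R x) < r / 2" "norm ((1 / 2 ^ n) *\<^sub>R y) < r / 2"
      using n r by linarith+
    ultimately show ?thesis
      using add[OF n] by (simp only: S_eq scaleR_add_right)
  qed
  have S_norm: "norm (S x) = norm x" for x
  proof -
    obtain n where n: "norm ((1 / 2 ^ n) *\<^sub>R x) < r / 2"
      using eventually_norm_scaled_less[of "r / 2" x] r by (auto simp: eventually_sequentially)
    then have "norm (f ((1 / 2 ^ n) *\<^sub>R x)) = norm ((1 / 2 ^ n) *\<^sub>R x)"
      using r by (intro norm_f) linarith
    then show ?thesis using S_eq[OF n] by simp
  qed
  have lin: "linear S"
    using S_add S_norm by (rule linear_if_additive_norm_preserving)
  moreover have "surj S"
  proof -
    have "\<exists>x. S x = y" for y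
    proof -
      obtain n where n: "norm ((1 / 2 ^ n) *\<^sub>R y) < r / 2"
        using eventually_norm_scaled_less[of "r / 2" y] r by (auto simp: eventually_sequentially)
      then have "norm ((1 / 2 ^ n) *\<^sub>R y) < r" using r by linarith
      then have "(1 / 2 ^ n) *\<^sub>R y \<in> f ` ball 0 r"
        using bij_betw_imp_surj_on[OF bij] by simp
      then obtain x where x: "norm x < r" "f x = (1 / 2 ^ n) *\<^sub>R y" by auto
      then have "S x = (1 / 2 ^ n) *\<^sub>R y" using S_f[of x] norm_f[of x] n by simp
      then have "S (2 ^ n *\<^sub>R x) = y" by (simp add: linear_scale[OF lin])
      then show ?thesis ..
    qed
    then show ?thesis unfolding surj_def by metis
  qed
  ultimately show ?thesis using S_norm S_f that by blast
qed

section \<open>From group isomorphisms to algebra isomorphisms\<close>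

theorem group_isometry_imp_algebra_isometry:
  fixes \<phi> :: "'a::real_normed_algebra_1 \<Rightarrow> 'b::real_normed_algebra_1"
  assumes \<phi>: "isometric_bijection \<phi> G H" and one: "\<phi> 1 = 1"
    and mult: "\<And>a b. \<lbrakk>a \<in> G; b \<in> G\<rbrakk> \<Longrightarrow> \<phi> (a * b) = \<phi> a * \<phi> b"
    and G: "ball 1 1 \<subseteq> G" and H: "ball 1 1 \<subseteq> H"
  shows "\<exists>S :: 'a \<Rightarrow> 'b. isometric_real_algebra_iso S"
proof -
  define f where "f x = \<phi> (1 + x) - 1" for x
  have bij: "bij_betw \<phi> G H"
    and iso: "\<And>a b. \<lbrakk>a \<in> G; b \<in> G\<rbrakk> \<Longrightarrow> dist (\<phi> a) (\<phi> b) = dist a b"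
    using \<phi> by (auto simp: isometric_bijection_def)
  have G1: "1 + x \<in> G" if "norm x < 1" for x
    using G that by (auto simp: dist_norm)
  have "1 \<in> G" using G1[of 0] by simp
  have f_iso: "dist (f x) (f y) = dist x y" if "x \<in> ball 0 1" "y \<in> ball 0 1" for x y
    using iso[OF G1 G1, of x y] that by (simp add: f_def dist_norm)
  have f0: "f 0 = 0" by (simp add: f_def one)
  have "f ` ball 0 1 = ball 0 1"
  proof
    show "f ` ball 0 1 \<subseteq> ball 0 1" using f_iso[of 0] f0 by auto
    show "ball 0 1 \<subseteq> f ` ball 0 1"
    proof
      fix v :: 'b assume v: "v \<in> ball 0 1"
      then have "1 + v \<in> H" using H by (auto simp: dist_norm)
      then obtain a where a: "a \<in> G" "\<phi> a = 1 + v"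
        using bij_betw_imp_surj_on[OF bij] by (metis imageE)
      then have "dist a 1 = norm v" using iso[OF a(1) \<open>1 \<in> G\<close>] one by (simp add: dist_norm)
      then have "a - 1 \<in> ball 0 1" using v by (simp add: dist_norm norm_minus_commute)
      moreover have "f (a - 1) = v" using a by (simp add: f_def)
      ultimately show "v \<in> f ` ball 0 1" by blast
    qed
  qed
  moreover have "inj_on f (ball 0 1)" by (metis dist_eq_0_iff f_iso inj_onI)
  ultimately have "isometric_bijection f (ball 0 1) (ball 0 1)"
    using f_iso unfolding isometric_bijection_def bij_betw_def by blast
  from local_Mazur_Ulam[OF zero_less_one this f0]
  obtain S where lin: "linear S" and "surj S" and S_norm: "\<And>x. norm (S x) = norm x"
    and S_f: "\<And>x. norm x < 1 / 2 \<Longrightarrow> S x = f x" by blast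
  have S_\<phi>: "\<phi> (1 + x) = 1 + S x" if "norm x < 1 / 2" for x
    using S_f[OF that] by (simp add: f_def)
  have small: "S (x * y) = S x * S y" if x: "norm x < 1 / 8" and y: "norm y < 1 / 8" for x y
  proof -
    have "norm (x * y) \<le> norm x * norm y" by (rule norm_mult_ineq)
    also have "\<dots> \<le> 1 / 8 * (1 / 8)" using x y by (intro mult_mono) auto
    finally have "norm (x + y + x * y) < 1 / 2"
      using x y norm_triangle_ineq[of "x + y" "x * y"] norm_triangle_ineq[of x y] by linarith
    then have "1 + S (x + y + x * y) = \<phi> (1 + (x + y + x * y))" by (rule S_\<phi>[symmetric])
    also have "1 + (x + y + x * y) = (1 + x) * (1 + y)" by (simp add: algebra_simps)
    also have "\<phi> ((1 + x) * (1 + y)) = (1 + S x) * (1 + S y)"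
      using mult[OF G1 G1, of x y] x y S_\<phi> by simp
    finally show ?thesis by (simp add: linear_add[OF lin] algebra_simps)
  qed
  have S_mult: "S (x * y) = S x * S y" for x y
  proof -
    have "\<forall>\<^sub>F n in sequentially. norm ((1 / 2 ^ n) *\<^sub>R x) < 1 / 8 \<and> norm ((1 / 2 ^ n) *\<^sub>R y) < 1 / 8"
      by (intro eventually_conj eventually_norm_scaled_less) auto
    then obtain n where "norm ((1 / 2 ^ n) *\<^sub>R x) < 1 / 8" "norm ((1 / 2 ^ n) *\<^sub>R y) < 1 / 8"
      by (auto simp: eventually_sequentially)
    from small[OF this] show ?thesis by (simp add: linear_scale[OF lin])
  qed
  have S_dist: "dist (S x) (S y) = dist x y" for x y
    using S_norm[of "x - y"] by (simp add: dist_norm linear_diff[OF lin])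
  then have "inj S" by (metis dist_eq_0_iff injI)
  then show ?thesis
    using lin \<open>surj S\<close> S_mult S_dist unfolding isometric_real_algebra_iso_def bij_def by blast
qed

lemma isometric_group_iso_imp_algebra_iso:
  fixes C :: "'a::real_normed_algebra_1 set" and D :: "'b::real_normed_algebra_1 set"
  assumes C: "subgroup C invertible_group" "ball 1 1 \<subseteq> C"
    and D: "subgroup D invertible_group" "ball 1 1 \<subseteq> D"
    and CD: "isometrically_isomorphic_groups
      (invertible_group\<lparr>carrier := C\<rparr>) (invertible_group\<lparr>carrier := D\<rparr>)"
  shows "\<exists>S :: 'a \<Rightarrow> 'b. isometric_real_algebra_iso S"
proof -
  let ?C = "invertible_group\<lparr>carrier := C\<rparr>" and ?D = "invertible_group\<lparr>carrier := D\<rparr>"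
  obtain \<phi> where \<phi>: "\<phi> \<in> iso ?C ?D"
    and dist: "\<And>x y. \<lbrakk>x \<in> C; y \<in> C\<rbrakk> \<Longrightarrow> dist (\<phi> x) (\<phi> y) = dist x y"
    using CD by (auto simp: isometrically_isomorphic_groups_def)
  have hom: "\<phi> \<in> hom ?C ?D" and bij: "bij_betw \<phi> C D"
    using \<phi> by (auto simp: iso_def)
  have "group ?C" "group ?D"
    using subgroup.subgroup_is_group[OF C(1) group_invertible_group]
      subgroup.subgroup_is_group[OF D(1) group_invertible_group] .
  from hom_one[OF hom this] have "\<phi> 1 = 1" by simp
  moreover have "\<phi> (a * b) = \<phi> a * \<phi> b" if "a \<in> C" "b \<in> C" for a b
    using hom_mult[OF hom, of a b] that by simp
  moreover have "isometric_bijection \<phi> C D"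
    using bij dist by (simp add: isometric_bijection_def)
  ultimately show ?thesis
    using C(2) D(2) by (intro group_isometry_imp_algebra_isometry[of \<phi> C D])
qed

section \<open>From algebra isomorphisms to group isomorphisms\<close>

lemma isometric_real_algebra_iso_inv:
  assumes "isometric_real_algebra_iso T"
  shows "isometric_real_algebra_iso (inv_into UNIV T)"
proof -
  have lin: "linear T" and bij: "bij T" and mult: "\<And>x y. T (x * y) = T x * T y"
    and dist: "\<And>x y. dist (T x) (T y) = dist x y"
    using assms by (auto simp: isometric_real_algebra_iso_def)
  have T_inv: "T (inv_into UNIV T y) = y" and inv_T: "inv_into UNIV T (T x) = x" for x y
    using bij by (simp_all add: bij_is_surj bij_is_inj surj_f_inv_f)
  have "linear (inv_into UNIV T)"
    by (rule linearI) (metis T_inv inv_T linear_add[OF lin], metis T_inv inv_T linear_scale[OF lin])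
  moreover have "inv_into UNIV T (x * y) = inv_into UNIV T x * inv_into UNIV T y" for x y
    by (metis T_inv inv_T mult)
  moreover have "dist (inv_into UNIV T x) (inv_into UNIV T y) = dist x y" for x y
    by (metis T_inv dist)
  ultimately show ?thesis
    using bij_imp_bij_inv[OF bij] by (simp add: isometric_real_algebra_iso_def)
qed

lemma isometric_real_algebra_iso_one:
  assumes "isometric_real_algebra_iso T"
  shows "T 1 = 1"
proof -
  have mult: "\<And>x y. T (x * y) = T x * T y" and "surj T"
    using assms by (auto simp: isometric_real_algebra_iso_def bij_is_surj)
  then obtain u where "T u = 1" by (metis surjD)
  then show ?thesis using mult[of u 1] by simp
qed

lemma algebra_iso_image_invertible_subset:
  assumes "isometric_real_algebra_iso T"
  shows "T ` carrier invertible_group \<subseteq> carrier invertible_group"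
  using assms isometric_real_algebra_iso_one[OF assms]
  unfolding carrier_invertible_group isometric_real_algebra_iso_def
  by (smt (verit) image_subset_iff mem_Collect_eq)

lemma algebra_iso_image_principal_component_subset:
  assumes T: "isometric_real_algebra_iso T"
  shows "T ` principal_component \<subseteq> principal_component"
proof -
  have "continuous_on U T" for U
    using T unfolding isometric_real_algebra_iso_def continuous_on_iff by metis
  then have "connected (T ` principal_component)"
    unfolding principal_component_def
    by (rule connected_continuous_image[OF _ connected_connected_component])
  moreover have "T ` principal_component \<subseteq> carrier invertible_group"
    using algebra_iso_image_invertible_subset[OF T]
      connected_component_subset[of "carrier invertible_group" 1]
    unfolding principal_component_def by blast
  moreover have "1 \<in> T ` principal_component"
    using isometric_real_algebra_iso_one[OF T] subgroup.one_closed[OF subgroup_principal_component]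
    by (metis image_eqI one_invertible_group)
  ultimately show ?thesis
    unfolding principal_component_def[where 'a = 'b] by (intro connected_component_maximal)
qed

text \<open>Two inclusions are required, rather than that the image of \<open>C\<close> equals \<open>D\<close>, because an inclusion
  that holds for every algebra isomorphism applies to \<open>T\<close> and to its inverse at once.\<close>

lemma algebra_iso_restricts_to_groups:
  fixes T :: "'a::real_normed_algebra_1 \<Rightarrow> 'b::real_normed_algebra_1"
  assumes T: "isometric_real_algebra_iso T" and CD: "T ` C \<subseteq> D" and DC: "inv_into UNIV T ` D \<subseteq> C"
  shows "isometrically_isomorphic_groups
    (invertible_group\<lparr>carrier := C\<rparr>) (invertible_group\<lparr>carrier := D\<rparr>)"
proof -
  have bij: "bij T" using T by (simp add: isometric_real_algebra_iso_def)
  have "bij_betw T C D"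
    by (rule bij_betw_byWitness[OF _ _ CD DC])
      (use bij in \<open>simp_all add: bij_is_surj bij_is_inj surj_f_inv_f\<close>)
  then have "T \<in> iso (invertible_group\<lparr>carrier := C\<rparr>) (invertible_group\<lparr>carrier := D\<rparr>)"
    using T CD by (auto simp: iso_def hom_def isometric_real_algebra_iso_def)
  then show ?thesis
    using T unfolding isometrically_isomorphic_groups_def isometric_real_algebra_iso_def by blast
qed

section \<open>The unit ball around the unit\<close>

text \<open>The inverse of a point \<open>x\<close> of the ball is the Neumann series in \<open>1 - x\<close>.\<close>

lemma ball_subset_invertible:
  "ball 1 1 \<subseteq> carrier (invertible_group :: 'a::{real_normed_algebra_1,banach} monoid)"
proof
  fix x :: 'a assume "x \<in> ball 1 1"
  define s where "s = suminf (\<lambda>n. (1 - x) ^ n)"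
  have sm: "summable (\<lambda>n. (1 - x) ^ n)"
    using \<open>x \<in> ball 1 1\<close> by (intro complete_algebra_summable_geometric) (simp add: dist_norm)
  have "suminf (\<lambda>n. (1 - x) ^ Suc n) = s - 1"
    using suminf_split_head[OF sm] by (simp add: s_def)
  then have "(1 - x) * s = s - 1" "s * (1 - x) = s - 1"
    using suminf_mult[OF sm, of "1 - x"] suminf_mult2[OF sm, of "1 - x"]
    by (simp_all only: s_def power_Suc power_commutes)
  then have "x * s = 1" "s * x = 1" by (simp_all add: algebra_simps)
  then show "x \<in> carrier invertible_group" by (auto simp: carrier_invertible_group)
qed

lemma ball_subset_principal_component:
  "ball 1 1 \<subseteq> (principal_component :: 'a::{real_normed_algebra_1,banach} set)"
  unfolding principal_component_def
  by (intro connected_component_maximal ball_subset_invertible convex_connected) auto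

section \<open>The equivalence\<close>

theorem corollary4p2:
  "(isometrically_isomorphic_groups
       (principal_component_group :: 'a::complex_banach_algebra_1 monoid)
       (principal_component_group :: 'b::complex_banach_algebra_1 monoid) \<longleftrightarrow>
     isometrically_isomorphic_groups
       (invertible_group :: 'a monoid) (invertible_group :: 'b monoid)) \<and>
   (isometrically_isomorphic_groups
       (invertible_group :: 'a monoid) (invertible_group :: 'b monoid) \<longrightarrow>
     (\<exists>T :: 'a \<Rightarrow> 'b. isometric_real_algebra_iso T))"
proof -
  let ?A = "invertible_group :: 'a monoid" and ?B = "invertible_group :: 'b monoid"
  have full: "?A = ?A\<lparr>carrier := carrier ?A\<rparr>" "?B = ?B\<lparr>carrier := carrier ?B\<rparr>" by simp_all
  have subgroup: "subgroup (carrier ?A) ?A" "subgroup (carrier ?B) ?B"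
    by (intro group.subgroup_self group_invertible_group)+
  have "isometrically_isomorphic_groups ?A ?B \<longleftrightarrow> (\<exists>T :: 'a \<Rightarrow> 'b. isometric_real_algebra_iso T)"
  proof
    assume "isometrically_isomorphic_groups ?A ?B"
    then show "\<exists>T :: 'a \<Rightarrow> 'b. isometric_real_algebra_iso T"
      using isometric_group_iso_imp_algebra_iso[OF subgroup(1) ball_subset_invertible
          subgroup(2) ball_subset_invertible] full by simp
  next
    assume "\<exists>T :: 'a \<Rightarrow> 'b. isometric_real_algebra_iso T"
    then obtain T :: "'a \<Rightarrow> 'b" where "isometric_real_algebra_iso T" ..
    then show "isometrically_isomorphic_groups ?A ?B"
      using algebra_iso_restricts_to_groups[of T "carrier ?A" "carrier ?B"] full
      by (simp add: algebra_iso_image_invertible_subset isometric_real_algebra_iso_inv)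
  qed
  moreover have "isometrically_isomorphic_groups
      (principal_component_group :: 'a monoid) (principal_component_group :: 'b monoid) \<longleftrightarrow>
    (\<exists>T :: 'a \<Rightarrow> 'b. isometric_real_algebra_iso T)"
    unfolding principal_component_group_def
  proof
    assume "isometrically_isomorphic_groups
      (?A\<lparr>carrier := principal_component\<rparr>) (?B\<lparr>carrier := principal_component\<rparr>)"
    then show "\<exists>T :: 'a \<Rightarrow> 'b. isometric_real_algebra_iso T"
      by (rule isometric_group_iso_imp_algebra_iso[OF
            subgroup_principal_component ball_subset_principal_component
            subgroup_principal_component ball_subset_principal_component])
  next
    assume "\<exists>T :: 'a \<Rightarrow> 'b. isometric_real_algebra_iso T"
    then obtain T :: "'a \<Rightarrow> 'b" where "isometric_real_algebra_iso T" ..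
    then show "isometrically_isomorphic_groups
      (?A\<lparr>carrier := principal_component\<rparr>) (?B\<lparr>carrier := principal_component\<rparr>)"
      by (intro algebra_iso_restricts_to_groups algebra_iso_image_principal_component_subset
          isometric_real_algebra_iso_inv)
  qed
  ultimately show ?thesis by blast
qed

end
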